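(* Let $p\in\mathbb C[z,\bar z]$ be a polynomial such that $\mathcal Z_p\neq\varnothing$, $0\notin\mathcal Z_p$ and $\psi_p$ is injective. Suppose $\gamma\colon\mathfrak N\to\mathbb C$ is a complex moment sequence having a representing measure supported in $\mathcal Z_p$. If $\mathsf{PDE}(\gamma)=\{\Gamma\}$ is a singleton, then $\gamma$ is determinate.
   Context: All measures are positive, and integrands are tacitly assumed to be absolutely integrable wherever integrals appear. Put $\mathbb C^*=\mathbb C\setminus\{0\}$, $\mathbb T=\{z\in\mathbb C:|z|=1\}$, $\mathfrak N=\{(m,n)\in\mathbb Z^2: m\ge 0,\ n\ge 0\}$ and $\mathfrak N_+=\{(m,n)\in\mathbb Z^2: m+n\ge 0\}$. Convention: $0^0=1$. A sequence $\gamma=\{\gamma_{m,n}\}_{(m,n)\in\mathfrak N}\subset\mathbb C$ is a complex moment sequence if there is a Borel measure $\mu$ on $\mathbb C$ with $\gamma_{m,n}=\int_{\mathbb C} z^m\bar z^n\,d\mu(z)$ for all $(m,n)\in\mathfrak N$; such $\mu$ is called a representing measure for $\gamma$. If $\mu$ is unique, $\gamma$ is called determinate. "Supported in" refers to the closed support. A sequence $\Gamma=\{\Gamma_{m,n}\}_{(m,n)\in\mathfrak N_+}\subset\mathbb C$ is positive definite on $\mathfrak N_+$ if $\sum_{(m,n),(p,q)\in\mathfrak N_+}\lambda_{m,n}\overline{\lambda_{p,q}}\,\Gamma_{m+q,n+p}\ge 0$ for every finitely supported family $\{\lambda_{m,n}\}_{(m,n)\in\mathfrak N_+}\subset\mathbb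 C$. $\mathsf{PDE}(\gamma)$ denotes the set of all sequences $\Gamma$ positive definite on $\mathfrak N_+$ with $\Gamma_{m,n}=\gamma_{m,n}$ for all $(m,n)\in\mathfrak N$. For $p\in\mathbb C[z,\bar z]$ (polynomials in two indeterminates with complex coefficients), $\mathcal Z_p=\{z\in\mathbb C:p(z,\bar z)=0\}$. The map $\psi\colon\mathbb C^*\to\mathbb T$ is $\psi(z)=z/\bar z$, and $\psi_p=\psi|_{\mathcal Z_p}$. *)

theory Defs
  imports "HOL-Analysis.Analysis" "HOL-Computational_Algebra.Polynomial"
begin

text \<open>A polynomial in \<open>\<complex>[z, \<zeta>]\<close> is an element of \<^typ>\<open>complex poly poly\<close>: the inner
  indeterminate is \<open>z\<close>, the outer one is \<open>\<zeta>\<close>, and \<open>\<zeta>\<close> is evaluated at the conjugate of \<open>z\<close>.\<close>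

definition eval_conj :: "complex poly poly \<Rightarrow> complex \<Rightarrow> complex" where
  "eval_conj p z = poly (poly p [:cnj z:]) z"

lemma eval_conj_eq_sum:
  "eval_conj p z = (\<Sum>n\<le>degree p. \<Sum>m\<le>degree (coeff p n). coeff (coeff p n) m * z ^ m * cnj z ^ n)"
proof -
  have "eval_conj p z = (\<Sum>n\<le>degree p. poly (coeff p n) z * cnj z ^ n)"
    by (simp add: eval_conj_def poly_altdef[of p] poly_sum)
  also have "\<dots> = (\<Sum>n\<le>degree p. \<Sum>m\<le>degree (coeff p n). coeff (coeff p n) m * z ^ m * cnj z ^ n)"
    by (simp add: poly_altdef sum_distrib_right)
  finally show ?thesis .
qed

definition zero_set :: "complex poly poly \<Rightarrow> complex set" where
  "zero_set p = {z. eval_conj p z = 0}"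

text \<open>Only the values of \<open>psi\<close> on \<open>\<complex> - {0}\<close> are meaningful.\<close>

definition psi :: "complex \<Rightarrow> complex" where
  "psi z = z / cnj z"

definition closed_support :: "'a::topological_space measure \<Rightarrow> 'a set" where
  "closed_support \<mu> = {x. \<forall>U. open U \<longrightarrow> x \<in> U \<longrightarrow> emeasure \<mu> U > 0}"

definition representing_measure :: "(nat \<Rightarrow> nat \<Rightarrow> complex) \<Rightarrow> complex measure \<Rightarrow> bool" where
  "representing_measure \<gamma> \<mu> \<longleftrightarrow>
     sets \<mu> = sets borel \<and>
     (\<forall>m n. integrable \<mu> (\<lambda>z. z ^ m * cnj z ^ n) \<and>
            \<gamma> m n = integral\<^sup>L \<mu> (\<lambda>z. z ^ m * cnj z ^ n))"

definition complex_moment_sequence :: "(nat \<Rightarrow> nat \<Rightarrow> complex) \<Rightarrow> bool" where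
  "complex_moment_sequence \<gamma> \<longleftrightarrow> (\<exists>\<mu>. representing_measure \<gamma> \<mu>)"

definition determinate :: "(nat \<Rightarrow> nat \<Rightarrow> complex) \<Rightarrow> bool" where
  "determinate \<gamma> \<longleftrightarrow> (\<exists>!\<mu>. representing_measure \<gamma> \<mu>)"

definition N_plus :: "(int \<times> int) set" where
  "N_plus = {(m, n). m + n \<ge> 0}"

definition positive_definite :: "(int \<times> int \<Rightarrow> complex) \<Rightarrow> bool" where
  "positive_definite \<Gamma> \<longleftrightarrow>
     (\<forall>c :: int \<times> int \<Rightarrow> complex. \<forall>S. S = {x \<in> N_plus. c x \<noteq> 0} \<longrightarrow> finite S \<longrightarrow>
        (\<Sum>(m, n)\<in>S. \<Sum>(p, q)\<in>S. c (m, n) * cnj (c (p, q)) * \<Gamma> (m + q, n + p)) \<in> \<real>\<^sub>\<ge>\<^sub>0)"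

text \<open>Sequences indexed by \<^const>\<open>N_plus\<close> are functions that are \<^const>\<open>undefined\<close> off
  \<^const>\<open>N_plus\<close>, so that equality of functions is equality of sequences; without this
  restriction \<open>PDE \<gamma>\<close> could never be a singleton.\<close>

definition PDE :: "(nat \<Rightarrow> nat \<Rightarrow> complex) \<Rightarrow> (int \<times> int \<Rightarrow> complex) set" where
  "PDE \<gamma> = {\<Gamma> \<in> extensional N_plus.
     positive_definite \<Gamma> \<and> (\<forall>m n. \<Gamma> (int m, int n) = \<gamma> m n)}"

end

theory Submission imports Defs begin

text \<open>
  Every representing measure of \<open>\<gamma>\<close> lives on \<open>zero_set p\<close>, because \<open>\<integral> \<bar>p\<bar>\<^sup>2\<close> is a
  combination of the moments and therefore vanishes for all representing measures as soon as it
  vanishes for one (\<open>AE_eval_conj_eq_0_transfer\<close>).  As \<open>0 \<notin> zero_set p\<close>, a representing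
  measure \<open>\<mu>\<close> has no atom at the origin, so the integrals \<open>\<integral> z\<^sup>m (cnj z)\<^sup>n d\<mu>\<close> make sense
  for all integers with \<open>m + n \<ge> 0\<close> and form an element of \<open>PDE \<gamma>\<close>
  (\<open>extended_moments_in_PDE\<close>).  If \<open>PDE \<gamma>\<close> is a singleton, any two representing measures
  share these integrals.

  On the antidiagonal \<open>m + n = 0\<close> the integrand is a power of \<open>psi z = z / cnj z\<close>, so the
  images of the two measures under \<open>psi\<close>, which are measures on the unit circle, have the same
  Fourier coefficients.  By the Stone--Weierstrass theorem the images coincide
  (\<open>representing_measure_unique_on_compact\<close>).  Finally \<open>psi\<close> is continuous and injective on the
  closed set \<open>zero_set p\<close>, and there no information is lost by passing to the image: a closed
  subset of \<open>zero_set p\<close> is a countable union of compact sets, so its image is Borel and has it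
  as preimage within \<open>zero_set p\<close> (\<open>measure_eqI_distr_inj\<close>).
\<close>

section \<open>Equality of finite Borel measures\<close>

lemma measure_eqI_closed:
  fixes M N :: "'a::topological_space measure"
  assumes sets: "sets M = sets borel" "sets N = sets borel"
    and "finite_measure M"
    and eq: "\<And>F. closed F \<Longrightarrow> emeasure M F = emeasure N F"
  shows "M = N"
proof (rule measure_eqI_generator_eq[where E = "Collect closed" and \<Omega> = UNIV and A = "\<lambda>_. UNIV"])
  show "Int_stable (Collect closed :: 'a set set)"
    by (auto simp: Int_stable_def)
  show "sets M = sigma_sets UNIV (Collect closed)" "sets N = sigma_sets UNIV (Collect closed)"
    using sets by (simp_all add: borel_eq_closed)
  show "emeasure M UNIV \<noteq> \<infinity>"
    using finite_measure.emeasure_finite[OF assms(3), of UNIV] by simp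
qed (use eq in auto)

text \<open>
  Polynomials are uniformly dense in the continuous functions on \<open>K\<close>, and continuous functions
  approximate indicators of closed sets.  Doing both approximations at once yields a sequence of
  polynomials that is bounded on \<open>K\<close> and tends to the indicator there.
\<close>

lemma measure_eqI_polynomial:
  fixes M N :: "'a::euclidean_space measure"
  assumes sets: "sets M = sets borel" "sets N = sets borel"
    and fin: "finite_measure M" "finite_measure N"
    and K: "compact K" "AE x in M. x \<in> K" "AE x in N. x \<in> K"
    and eq: "\<And>f :: 'a \<Rightarrow> real. real_polynomial_function f \<Longrightarrow> integral\<^sup>L M f = integral\<^sup>L N f"
  shows "M = N"
proof (rule measure_eqI_closed[OF sets fin(1)])
  fix F :: "'a set"
  assume F: "closed F"
  show "emeasure M F = emeasure N F"
  proof (cases "F = {}")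
    case False
    define f where "f n x = max 0 (1 - real n * infdist x F)" for n x
    have "\<exists>g. real_polynomial_function g \<and> (\<forall>x\<in>K. \<bar>f n x - g x\<bar> < 1 / Suc n)" for n
    proof -
      have "continuous_on K (f n)"
        unfolding f_def by (intro continuous_intros)
      then show ?thesis
        using Stone_Weierstrass_real_polynomial_function[OF K(1), of "f n" "1 / Suc n"]
        by (metis of_nat_0_less_iff zero_less_Suc zero_less_divide_1_iff)
    qed
    then obtain g where g: "\<And>n. real_polynomial_function (g n)"
        and fg: "\<And>n x. x \<in> K \<Longrightarrow> \<bar>f n x - g n x\<bar> < 1 / Suc n"
      by metis
    have f_lim: "(\<lambda>n. f n x) \<longlonglongrightarrow> indicator F x" for x
    proof (cases "x \<in> F")
      case True
      then show ?thesis by (simp add: f_def)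
    next
      case x: False
      then have "infdist x F > 0"
        using F False by (metis in_closed_iff_infdist_zero infdist_nonneg less_eq_real_def)
      then obtain k where k: "real k * infdist x F > 1"
        using reals_Archimedean3 by blast
      have "f n x = 0" if "n \<ge> k" for n
      proof -
        have "real k * infdist x F \<le> real n * infdist x F"
          using that by (intro mult_right_mono) (auto simp: infdist_nonneg)
        then show ?thesis using k by (simp add: f_def)
      qed
      then have "eventually (\<lambda>n. f n x = 0) sequentially"
        by (auto simp: eventually_sequentially)
      then show ?thesis
        using x by (simp add: tendsto_eventually)
    qed
    have g_lim: "(\<lambda>n. g n x) \<longlonglongrightarrow> indicator F x" if "x \<in> K" for x
    proof -
      have "(\<lambda>n. f n x - g n x) \<longlonglongrightarrow> 0"
        by (rule Lim_null_comparison[OF _ lim_inverse_n'[THEN LIMSEQ_Suc]])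
          (use fg[OF that] in \<open>auto intro!: always_eventually less_imp_le\<close>)
      from tendsto_diff[OF f_lim[of x] this] show ?thesis by simp
    qed
    have g_bound: "\<bar>g n x\<bar> \<le> 2" if "x \<in> K" for n x
    proof -
      have "\<bar>f n x\<bar> \<le> 1" by (auto simp: f_def infdist_nonneg)
      moreover have "1 / real (Suc n) \<le> 1" by simp
      ultimately show ?thesis using fg[OF that, of n] by linarith
    qed
    have lim: "(\<lambda>n. integral\<^sup>L L (g n)) \<longlonglongrightarrow> measure L F"
      if L: "sets L = sets borel" "finite_measure L" "AE x in L. x \<in> K" for L
    proof -
      interpret L: finite_measure L by fact
      have "(\<lambda>n. integral\<^sup>L L (g n)) \<longlonglongrightarrow> integral\<^sup>L L (indicator F :: 'a \<Rightarrow> real)"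
      proof (rule integral_dominated_convergence[where w = "\<lambda>_. 2"])
        show "indicator F \<in> borel_measurable L" "g n \<in> borel_measurable L" for n
          using F g[of n]
          by (auto simp: measurable_cong_sets[OF L(1) refl]
              intro!: borel_measurable_indicator borel_measurable_continuous_onI
                continuous_on_polymonial_function
              simp flip: real_polynomial_function_eq)
        show "AE x in L. (\<lambda>n. g n x) \<longlonglongrightarrow> indicator F x"
          using L(3) by eventually_elim (rule g_lim)
        show "AE x in L. norm (g n x) \<le> 2" for n
          using L(3) by eventually_elim (simp add: g_bound)
      qed simp
      also have "integral\<^sup>L L (indicator F :: 'a \<Rightarrow> real) = measure L F"
        using F L(1) by simp
      finally show ?thesis .
    qed
    have "measure M F = measure N F"
      using LIMSEQ_unique[OF lim[OF sets(1) fin(1) K(2)]] lim[OF sets(2) fin(2) K(3)] eq[OF g]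
      by simp
    then show ?thesis
      using fin by (simp add: finite_measure.emeasure_eq_measure)
  qed simp
qed

text \<open>
  Images of Borel sets under Borel maps need not be Borel, but a closed subset of Euclidean space is
  a countable union of compact sets, and so is its continuous image.
\<close>

lemma measure_eqI_distr_inj:
  fixes M N :: "'a::euclidean_space measure" and f :: "'a \<Rightarrow> 'b::t2_space"
  assumes sets: "sets M = sets borel" "sets N = sets borel"
    and fin: "finite_measure M"
    and f: "f \<in> borel_measurable borel" "continuous_on S f" "inj_on f S"
    and S: "closed S" "AE x in M. x \<in> S" "AE x in N. x \<in> S"
    and eq: "distr M borel f = distr N borel f"
  shows "M = N"
proof (rule measure_eqI_closed[OF sets fin])
  fix F :: "'a set"
  assume F: "closed F"
  have "compact (cball 0 (real n) \<inter> (F \<inter> S))" for n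
    by (intro compact_Int_closed compact_cball closed_Int F S(1))
  then have "compact (f ` (cball 0 (real n) \<inter> (F \<inter> S)))" for n
    by (rule compact_continuous_image[rotated]) (use f(2) in \<open>auto intro: continuous_on_subset\<close>)
  then have "(\<Union>n. f ` (cball 0 (real n) \<inter> (F \<inter> S))) \<in> sets borel"
    by (intro sets.countable_UN borel_closed compact_imp_closed image_subsetI) auto
  also have "(\<Union>n. f ` (cball 0 (real n) \<inter> (F \<inter> S))) = f ` (F \<inter> S)"
  proof -
    have "(\<Union>n. cball 0 (real n)) = (UNIV :: 'a set)"
      by (auto simp: real_arch_simple)
    then have "f ` (F \<inter> S) = f ` ((\<Union>n. cball 0 (real n)) \<inter> (F \<inter> S))"
      by simp
    also have "\<dots> = (\<Union>n. f ` (cball 0 (real n) \<inter> (F \<inter> S)))"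
      by blast
    finally show ?thesis ..
  qed
  finally have image: "f ` (F \<inter> S) \<in> sets borel" .
  have preimage: "emeasure L F = emeasure (distr L borel f) (f ` (F \<inter> S))"
    if L: "sets L = sets borel" "AE x in L. x \<in> S" for L
  proof -
    have f_L: "f \<in> measurable L borel"
      using f(1) by (simp add: measurable_cong_sets[OF L(1) refl])
    have "emeasure L F = emeasure L (f -` f ` (F \<inter> S) \<inter> space L)"
    proof (rule emeasure_eq_AE)
      show "AE x in L. x \<in> F \<longleftrightarrow> x \<in> f -` f ` (F \<inter> S) \<inter> space L"
        using L(2) AE_space
        by eventually_elim (use f(3) in \<open>auto dest: inj_onD\<close>)
    qed (use F L(1) measurable_sets[OF f_L image] in auto)
    then show ?thesis
      by (simp add: emeasure_distr[OF f_L image])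
  qed
  show "emeasure M F = emeasure N F"
    using preimage[OF sets(1) S(2)] preimage[OF sets(2) S(3)] eq by simp
qed

text \<open>The complement of the support is a union of open null sets, and by second countability
  countably many of them suffice.\<close>

lemma AE_closed_support:
  fixes \<mu> :: "'a::second_countable_topology measure"
  assumes sets: "sets \<mu> = sets borel"
  shows "AE x in \<mu>. x \<in> closed_support \<mu>"
proof -
  define \<U> where "\<U> = {U. open U \<and> emeasure \<mu> U = 0}"
  obtain \<V> where \<V>: "\<V> \<subseteq> \<U>" "countable \<V>" "\<Union>\<V> = \<Union>\<U>"
    by (rule Lindelof[of \<U>]) (auto simp: \<U>_def)
  have "\<Union>\<V> \<in> null_sets \<mu>"
    using null_sets_UN'[OF \<V>(2), of "\<lambda>U. U" \<mu>] \<V>(1) sets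
    by (simp add: \<U>_def null_sets_def subset_iff)
  then have "AE x in \<mu>. x \<notin> \<Union>\<V>"
    by (rule AE_not_in)
  then show ?thesis
    by eventually_elim
      (auto simp: \<V>(3) closed_support_def \<U>_def zero_less_iff_neq_zero)
qed

section \<open>Moments determine the integrals of polynomials\<close>

lemma eval_conj_simps [simp]:
  "eval_conj 0 z = 0"
  "eval_conj (p + q) z = eval_conj p z + eval_conj q z"
  "eval_conj (p * q) z = eval_conj p z * eval_conj q z"
  "eval_conj [:[:c:]:] z = c"
  by (simp_all add: eval_conj_def)

lemma eval_conj_sum: "eval_conj (sum p A) z = (\<Sum>i\<in>A. eval_conj (p i) z)"
  by (induction A rule: infinite_finite_induct) auto

lemma continuous_on_eval_conj [continuous_intros]: "continuous_on S (eval_conj p)"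
  unfolding eval_conj_eq_sum[abs_def] by (intro continuous_intros)

lemma closed_zero_set: "closed (zero_set p)"
  unfolding zero_set_def by (intro closed_Collect_eq continuous_intros)

lemma eval_conj_monom: "eval_conj (monom (monom c m) n) z = c * z ^ m * cnj z ^ n"
  by (simp add: eval_conj_def poly_monom)

lemma cnj_eval_conj: "\<exists>q. \<forall>z. cnj (eval_conj p z) = eval_conj q z"
proof (intro exI allI)
  fix z
  show "cnj (eval_conj p z) = eval_conj
     (\<Sum>n\<le>degree p. \<Sum>m\<le>degree (coeff p n). monom (monom (cnj (coeff (coeff p n) m)) n) m) z"
    by (simp add: eval_conj_sum eval_conj_monom eval_conj_eq_sum[of p] mult_ac)
qed

lemma real_polynomial_function_eval_conj:
  fixes f :: "complex \<Rightarrow> real"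
  assumes "real_polynomial_function f"
  shows "\<exists>q. \<forall>z. complex_of_real (f z) = eval_conj q z"
  using assms
proof induction
  case (linear f)
  then interpret bounded_linear f .
  \<comment> \<open>The coefficients come from \<open>Re z = (z + cnj z) / 2\<close> and
    \<open>Im z = (z - cnj z) / (2 * \<i>)\<close>.\<close>
  define a where "a = Complex (f 1 / 2) (- f \<i> / 2)"
  have "complex_of_real (f z) = eval_conj [:[:0, a:], [:cnj a:]:] z" for z
  proof -
    have "z = Re z *\<^sub>R 1 + Im z *\<^sub>R \<i>"
      by (simp add: complex_eq_iff)
    then have "f z = Re z * f 1 + Im z * f \<i>"
      by (metis add scaleR real_scaleR_def)
    then show ?thesis
      by (simp add: a_def eval_conj_def complex_eq_iff algebra_simps)
  qed
  then show ?case by blast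
next
  case (const c)
  show ?case
    by (metis eval_conj_simps(4))
next
  case (add f g)
  then show ?case by (metis eval_conj_simps(2) of_real_add)
next
  case (mult f g)
  then show ?case by (metis eval_conj_simps(3) of_real_mult)
qed

lemma finite_measure_representing:
  assumes "representing_measure \<gamma> \<mu>"
  shows "finite_measure \<mu>"
proof -
  have "integrable \<mu> (\<lambda>z. z ^ 0 * cnj z ^ 0)"
    using assms unfolding representing_measure_def by blast
  then show ?thesis
    by (intro finite_measureI) (simp add: integrable_iff_bounded)
qed

lemma representing_measure_eval_conj:
  assumes "representing_measure \<gamma> \<mu>"
  shows "integrable \<mu> (eval_conj p)"
    and "integral\<^sup>L \<mu> (eval_conj p) =
      (\<Sum>n\<le>degree p. \<Sum>m\<le>degree (coeff p n). coeff (coeff p n) m * \<gamma> m n)"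
proof -
  have int: "integrable \<mu> (\<lambda>z. c * z ^ m * cnj z ^ n)"
    and val: "integral\<^sup>L \<mu> (\<lambda>z. c * z ^ m * cnj z ^ n) = c * \<gamma> m n" for m n c
    using assms by (auto simp: representing_measure_def mult.assoc)
  show "integrable \<mu> (eval_conj p)"
    unfolding eval_conj_eq_sum[abs_def] by (intro Bochner_Integration.integrable_sum int)
  show "integral\<^sup>L \<mu> (eval_conj p) =
      (\<Sum>n\<le>degree p. \<Sum>m\<le>degree (coeff p n). coeff (coeff p n) m * \<gamma> m n)"
    unfolding eval_conj_eq_sum[abs_def]
    by (simp add: int val Bochner_Integration.integral_sum Bochner_Integration.integrable_sum)
qed

lemma representing_measure_unique_on_compact:
  assumes \<mu>: "representing_measure \<gamma> \<mu>" "representing_measure \<gamma> \<nu>"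
    and K: "compact K" "AE z in \<mu>. z \<in> K" "AE z in \<nu>. z \<in> K"
  shows "\<mu> = \<nu>"
proof (rule measure_eqI_polynomial[OF _ _ _ _ K])
  fix f :: "complex \<Rightarrow> real"
  assume "real_polynomial_function f"
  then obtain q where q: "\<And>z. complex_of_real (f z) = eval_conj q z"
    using real_polynomial_function_eval_conj by blast
  have "complex_of_real (integral\<^sup>L \<mu> f) = complex_of_real (integral\<^sup>L \<nu> f)"
    using representing_measure_eval_conj(2)[OF \<mu>(1), of q]
      representing_measure_eval_conj(2)[OF \<mu>(2), of q]
    by (simp add: q flip: integral_complex_of_real)
  then show "integral\<^sup>L \<mu> f = integral\<^sup>L \<nu> f"
    by simp
qed (use \<mu> in \<open>auto simp: representing_measure_def intro: finite_measure_representing\<close>)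

text \<open>The function \<open>\<bar>p\<bar>\<^sup>2\<close> is again a polynomial in \<open>z\<close> and \<open>cnj z\<close>, so its integral is
  the same for all representing measures.\<close>

lemma AE_eval_conj_eq_0_transfer:
  assumes \<mu>: "representing_measure \<gamma> \<mu>" "representing_measure \<gamma> \<nu>"
    and p: "AE z in \<mu>. eval_conj p z = 0"
  shows "AE z in \<nu>. eval_conj p z = 0"
proof -
  obtain q where q: "\<And>z. cnj (eval_conj p z) = eval_conj q z"
    using cnj_eval_conj by blast
  have sq: "eval_conj (p * q) z = complex_of_real ((cmod (eval_conj p z))\<^sup>2)" for z
    by (simp only: complex_norm_square eval_conj_simps q)
  have "complex_of_real (\<integral>z. (cmod (eval_conj p z))\<^sup>2 \<partial>\<nu>) = integral\<^sup>L \<nu> (eval_conj (p * q))"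
    by (simp only: sq[abs_def] integral_complex_of_real)
  also have "\<dots> = integral\<^sup>L \<mu> (eval_conj (p * q))"
    by (simp only: representing_measure_eval_conj(2)[OF \<mu>(1)]
        representing_measure_eval_conj(2)[OF \<mu>(2)])
  also have "\<dots> = 0"
    by (rule integral_eq_zero_AE) (use p in eventually_elim, simp)
  finally have "(\<integral>z. (cmod (eval_conj p z))\<^sup>2 \<partial>\<nu>) = 0"
    by simp
  moreover have "integrable \<nu> (\<lambda>z. (cmod (eval_conj p z))\<^sup>2)"
    using integrable_Re[OF representing_measure_eval_conj(1)[OF \<mu>(2), of "p * q"]]
    by (simp only: sq Re_complex_of_real)
  ultimately show ?thesis
    by (subst (asm) integral_nonneg_eq_0_iff_AE) auto
qed

section \<open>Moments with integer exponents\<close>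

text \<open>At the origin, where negative powers take the default value \<open>0\<close>, the exponents do not add
  up.  The measures considered below give no mass to that point.\<close>

definition laurent_monomial :: "int \<times> int \<Rightarrow> complex \<Rightarrow> complex" where
  "laurent_monomial = (\<lambda>(m, n) z. z powi m * cnj z powi n)"

definition extended_moments :: "complex measure \<Rightarrow> int \<times> int \<Rightarrow> complex" where
  "extended_moments \<mu> = restrict (\<lambda>x. integral\<^sup>L \<mu> (laurent_monomial x)) N_plus"

lemma laurent_monomial_mult_cnj:
  assumes "z \<noteq> 0"
  shows "laurent_monomial (m, n) z * cnj (laurent_monomial (k, l) z) =
    laurent_monomial (m + l, n + k) z"
  using assms by (simp add: laurent_monomial_def power_int_add mult_ac)

text \<open>The moments with nonnegative exponents already bound these integrals: away from the origin,
  the modulus of a Laurent monomial with \<open>m + n \<ge> 0\<close> is that of the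
  ordinary monomial \<open>z\<^sup>m\<^sup>+\<^sup>n\<close>.\<close>

lemma integrable_laurent_monomial:
  assumes \<mu>: "representing_measure \<gamma> \<mu>" and nz: "AE z in \<mu>. z \<noteq> 0" and x: "x \<in> N_plus"
  shows "integrable \<mu> (laurent_monomial x)"
proof -
  obtain m n where mn: "x = (m, n)" "m + n \<ge> 0"
    using x by (auto simp: N_plus_def)
  have sets: "sets \<mu> = sets borel"
    using \<mu> by (simp add: representing_measure_def)
  have "integrable \<mu> (\<lambda>z. z ^ nat (m + n) * cnj z ^ 0)"
    using \<mu> unfolding representing_measure_def by blast
  then show ?thesis
  proof (rule Bochner_Integration.integrable_bound)
    have "continuous_on (- {0}) (laurent_monomial x)"
      unfolding mn laurent_monomial_def by (auto intro!: continuous_intros)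
    then have "laurent_monomial x \<in> borel_measurable borel"
      by (rule borel_measurable_continuous_countable_exceptions[rotated]) simp
    then show "laurent_monomial x \<in> borel_measurable \<mu>"
      by (simp add: measurable_cong_sets[OF sets refl])
    show "AE z in \<mu>. norm (laurent_monomial x z) \<le> norm (z ^ nat (m + n) * cnj z ^ 0)"
      using nz
    proof eventually_elim
      case (elim z)
      have "norm (laurent_monomial x z) = norm z powi (m + n)"
        using elim by (simp add: mn laurent_monomial_def norm_mult norm_power_int power_int_add)
      also have "\<dots> = norm z ^ nat (m + n)"
        using mn by (simp add: power_int_def)
      finally show ?case
        by (simp add: norm_power)
    qed
  qed
qed

text \<open>The quadratic form of the extended moments at \<open>c\<close> is the integral of the squared modulus of
  the Laurent polynomial with coefficients \<open>c\<close>.\<close>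

lemma positive_definite_extended_moments:
  assumes \<mu>: "representing_measure \<gamma> \<mu>" and nz: "AE z in \<mu>. z \<noteq> 0"
  shows "positive_definite (extended_moments \<mu>)"
  unfolding positive_definite_def
proof (intro allI impI)
  fix c :: "int \<times> int \<Rightarrow> complex" and S
  assume S: "S = {x \<in> N_plus. c x \<noteq> 0}" and "finite S"
  define e where "e x y = (fst x + snd y, snd x + fst y)" for x y :: "int \<times> int"
  have e: "e x y \<in> N_plus" if "x \<in> S" "y \<in> S" for x y
    using that by (auto simp: S e_def N_plus_def)
  define h where "h z = (\<Sum>x\<in>S. c x * laurent_monomial x z)" for z
  have "(\<Sum>(m, n)\<in>S. \<Sum>(p, q)\<in>S. c (m, n) * cnj (c (p, q)) * extended_moments \<mu> (m + q, n + p))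
    = (\<Sum>x\<in>S. \<Sum>y\<in>S. c x * cnj (c y) * extended_moments \<mu> (e x y))"
    by (simp add: case_prod_unfold e_def)
  also have "\<dots> = (\<Sum>x\<in>S. \<Sum>y\<in>S. \<integral>z. c x * cnj (c y) * laurent_monomial (e x y) z \<partial>\<mu>)"
    by (intro sum.cong refl) (simp add: extended_moments_def e)
  also have "\<dots> = (\<integral>z. (\<Sum>x\<in>S. \<Sum>y\<in>S. c x * cnj (c y) * laurent_monomial (e x y) z) \<partial>\<mu>)"
  proof -
    have int: "integrable \<mu> (\<lambda>z. c x * cnj (c y) * laurent_monomial (e x y) z)"
      if "x \<in> S" "y \<in> S" for x y
      using integrable_laurent_monomial[OF \<mu> nz e[OF that]] by simp
    show ?thesis
      by (simp add: int Bochner_Integration.integral_sum Bochner_Integration.integrable_sum)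
  qed
  also have "\<dots> = (\<integral>z. complex_of_real ((cmod (h z))\<^sup>2) \<partial>\<mu>)"
  proof (rule integral_cong_AE)
    have lm: "laurent_monomial x \<in> borel_measurable \<mu>" if "x \<in> N_plus" for x
      using integrable_laurent_monomial[OF \<mu> nz that] by (rule borel_measurable_integrable)
    show "(\<lambda>z. \<Sum>x\<in>S. \<Sum>y\<in>S. c x * cnj (c y) * laurent_monomial (e x y) z) \<in> borel_measurable \<mu>"
      by (intro borel_measurable_sum borel_measurable_times borel_measurable_const lm e)
    have "h \<in> borel_measurable \<mu>"
      unfolding h_def by (intro borel_measurable_sum borel_measurable_times borel_measurable_const lm)
        (simp add: S)
    then show "(\<lambda>z. complex_of_real ((cmod (h z))\<^sup>2)) \<in> borel_measurable \<mu>"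
      by measurable
    show "AE z in \<mu>. (\<Sum>x\<in>S. \<Sum>y\<in>S. c x * cnj (c y) * laurent_monomial (e x y) z) =
        complex_of_real ((cmod (h z))\<^sup>2)"
      using nz
    proof eventually_elim
      case (elim z)
      have "complex_of_real ((cmod (h z))\<^sup>2) = h z * cnj (h z)"
        by (simp only: complex_norm_square)
      also have "\<dots> = (\<Sum>x\<in>S. \<Sum>y\<in>S.
          c x * cnj (c y) * (laurent_monomial x z * cnj (laurent_monomial y z)))"
        by (simp add: h_def sum_product mult_ac)
      also have "\<dots> = (\<Sum>x\<in>S. \<Sum>y\<in>S. c x * cnj (c y) * laurent_monomial (e x y) z)"
        using laurent_monomial_mult_cnj[OF elim]
        by (intro sum.cong refl) (metis e_def prod.collapse)
      finally show ?case by simp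
    qed
  qed
  also have "\<dots> = complex_of_real (\<integral>z. (cmod (h z))\<^sup>2 \<partial>\<mu>)"
    by (rule integral_complex_of_real)
  also have "\<dots> \<in> \<real>\<^sub>\<ge>\<^sub>0"
    by simp
  finally show "(\<Sum>(m, n)\<in>S. \<Sum>(p, q)\<in>S.
      c (m, n) * cnj (c (p, q)) * extended_moments \<mu> (m + q, n + p)) \<in> \<real>\<^sub>\<ge>\<^sub>0" .
qed

lemma extended_moments_in_PDE:
  assumes \<mu>: "representing_measure \<gamma> \<mu>" and nz: "AE z in \<mu>. z \<noteq> 0"
  shows "extended_moments \<mu> \<in> PDE \<gamma>"
proof -
  have "extended_moments \<mu> (int m, int n) = \<gamma> m n" for m n
    using \<mu> by (simp add: extended_moments_def N_plus_def laurent_monomial_def representing_measure_def)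
  then show ?thesis
    using positive_definite_extended_moments[OF assms]
    by (simp add: PDE_def extended_moments_def)
qed

section \<open>The image on the unit circle\<close>

lemma psi_measurable: "psi \<in> borel_measurable borel"
  unfolding psi_def[abs_def]
  by (intro borel_measurable_divide borel_measurable_continuous_onI continuous_intros)

lemma norm_psi: "z \<noteq> 0 \<Longrightarrow> norm (psi z) = 1"
  by (simp add: psi_def norm_divide)

text \<open>On the unit circle \<open>cnj u = 1 / u\<close>, so the moments of the image are its Fourier
  coefficients, and these are the extended moments on the antidiagonal.\<close>

lemma representing_measure_distr_psi:
  assumes \<mu>: "representing_measure \<gamma> \<mu>" and nz: "AE z in \<mu>. z \<noteq> 0"
  shows "representing_measure
    (\<lambda>m n. extended_moments \<mu> (int m - int n, int n - int m)) (distr \<mu> borel psi)"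
proof -
  have sets: "sets \<mu> = sets borel"
    using \<mu> by (simp add: representing_measure_def)
  have psi_m: "psi \<in> measurable \<mu> borel"
    using psi_measurable by (simp add: measurable_cong_sets[OF sets refl])
  have mon_m: "(\<lambda>u. u ^ m * cnj u ^ n) \<in> borel_measurable borel" for m n
    by (intro borel_measurable_continuous_onI continuous_intros)
  {
    fix m n :: nat
    let ?x = "(int m - int n, int n - int m)"
    have x: "?x \<in> N_plus"
      by (simp add: N_plus_def)
    note int = integrable_laurent_monomial[OF \<mu> nz x]
    have eq: "AE z in \<mu>. psi z ^ m * cnj (psi z) ^ n = laurent_monomial ?x z"
      using nz
    proof eventually_elim
      case (elim z)
      then show ?case
        by (simp add: psi_def laurent_monomial_def power_int_diff power_divide)
    qed
    have comp_m: "(\<lambda>z. psi z ^ m * cnj (psi z) ^ n) \<in> borel_measurable \<mu>"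
      by (rule measurable_compose[OF psi_m mon_m])
    have "integrable \<mu> (\<lambda>z. psi z ^ m * cnj (psi z) ^ n)"
      using integrable_cong_AE[OF comp_m borel_measurable_integrable[OF int] eq] int by simp
    then have "integrable (distr \<mu> borel psi) (\<lambda>u. u ^ m * cnj u ^ n)"
      by (simp add: integrable_distr_eq[OF psi_m mon_m])
    moreover have "extended_moments \<mu> ?x = integral\<^sup>L (distr \<mu> borel psi) (\<lambda>u. u ^ m * cnj u ^ n)"
      using integral_cong_AE[OF comp_m borel_measurable_integrable[OF int] eq] x
      by (simp add: integral_distr[OF psi_m mon_m] extended_moments_def)
    ultimately have "integrable (distr \<mu> borel psi) (\<lambda>u. u ^ m * cnj u ^ n) \<and>
        extended_moments \<mu> ?x = integral\<^sup>L (distr \<mu> borel psi) (\<lambda>u. u ^ m * cnj u ^ n)" ..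
  }
  then show ?thesis
    by (simp add: representing_measure_def)
qed

lemma distr_psi_eqI:
  assumes \<mu>: "representing_measure \<gamma> \<mu>" "AE z in \<mu>. z \<noteq> 0"
    and \<nu>: "representing_measure \<delta> \<nu>" "AE z in \<nu>. z \<noteq> 0"
    and eq: "extended_moments \<mu> = extended_moments \<nu>"
  shows "distr \<mu> borel psi = distr \<nu> borel psi"
proof (rule representing_measure_unique_on_compact)
  show "representing_measure (\<lambda>m n. extended_moments \<nu> (int m - int n, int n - int m))
      (distr \<mu> borel psi)"
    using representing_measure_distr_psi[OF \<mu>] by (simp add: eq)
  show "representing_measure (\<lambda>m n. extended_moments \<nu> (int m - int n, int n - int m))
      (distr \<nu> borel psi)"
    by (rule representing_measure_distr_psi[OF \<nu>])
  have "AE u in distr \<mu> borel psi. u \<in> sphere 0 1"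
    if "representing_measure \<gamma> \<mu>" "AE z in \<mu>. z \<noteq> 0" for \<gamma> \<mu>
  proof -
    have sets: "sets \<mu> = sets borel"
      using that by (simp add: representing_measure_def)
    have "psi \<in> measurable \<mu> borel"
      using psi_measurable by (simp add: measurable_cong_sets[OF sets refl])
    moreover have "AE z in \<mu>. psi z \<in> sphere 0 1"
      using that(2) by eventually_elim (simp add: norm_psi)
    moreover have "{u \<in> space borel. u \<in> (sphere 0 1 :: complex set)} \<in> sets borel"
      by (simp add: borel_closed)
    ultimately show ?thesis
      by (subst AE_distr_iff) auto
  qed
  from this[OF \<mu>] this[OF \<nu>]
  show "AE u in distr \<mu> borel psi. u \<in> sphere 0 1" "AE u in distr \<nu> borel psi. u \<in> sphere 0 1" .
qed simp

section \<open>Determinacy\<close>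

theorem corollary23:
  fixes p :: "complex poly poly"
    and \<gamma> :: "nat \<Rightarrow> nat \<Rightarrow> complex"
    and \<Gamma> :: "int \<times> int \<Rightarrow> complex"
  assumes "zero_set p \<noteq> {}"
    and "0 \<notin> zero_set p"
    and "inj_on psi (zero_set p)"
    and "complex_moment_sequence \<gamma>"
    and "\<exists>\<mu>. representing_measure \<gamma> \<mu> \<and> closed_support \<mu> \<subseteq> zero_set p"
    and "PDE \<gamma> = {\<Gamma>}"
  shows "determinate \<gamma>"
proof -
  obtain \<mu> where \<mu>: "representing_measure \<gamma> \<mu>" "closed_support \<mu> \<subseteq> zero_set p"
    using assms(5) by blast
  have "AE z in \<mu>. z \<in> closed_support \<mu>"
    using \<mu>(1) by (intro AE_closed_support) (simp add: representing_measure_def)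
  then have \<mu>_zero: "AE z in \<mu>. eval_conj p z = 0"
    by eventually_elim (use \<mu>(2) in \<open>auto simp: zero_set_def\<close>)
  have on_zero_set: "AE z in \<nu>. z \<in> zero_set p" if "representing_measure \<gamma> \<nu>" for \<nu>
    using AE_eval_conj_eq_0_transfer[OF \<mu>(1) that \<mu>_zero] by (simp add: zero_set_def)
  have nonzero: "AE z in \<nu>. z \<noteq> 0" if "representing_measure \<gamma> \<nu>" for \<nu>
    using on_zero_set[OF that] by eventually_elim (use assms(2) in blast)
  have moments: "extended_moments \<nu> = \<Gamma>" if "representing_measure \<gamma> \<nu>" for \<nu>
    using extended_moments_in_PDE[OF that nonzero[OF that]] assms(6) by simp
  have "\<nu> = \<mu>" if \<nu>: "representing_measure \<gamma> \<nu>" for \<nu>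
  proof (rule measure_eqI_distr_inj)
    show "distr \<nu> borel psi = distr \<mu> borel psi"
      by (rule distr_psi_eqI[OF \<nu> nonzero[OF \<nu>] \<mu>(1) nonzero[OF \<mu>(1)]])
        (simp add: moments \<nu> \<mu>(1))
    show "continuous_on (zero_set p) psi"
      unfolding psi_def[abs_def] using assms(2) by (auto intro!: continuous_intros)
    show "finite_measure \<nu>"
      by (rule finite_measure_representing[OF \<nu>])
  qed (use \<nu> \<mu>(1) assms(3) psi_measurable closed_zero_set on_zero_set
      in \<open>auto simp: representing_measure_def\<close>)
  with \<mu>(1) show ?thesis
    unfolding determinate_def by blast
qed

end
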